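(* Let $0<\varepsilon<\frac12$, $0<\delta<1$, $\zeta>0$ and $\rho>0$. Let $\tau=\left\lceil \dfrac{\ln\left(\frac{1}{2\varepsilon^2}\ln\frac{1}{1-\varepsilon}\right)}{\ln(1+\rho)}\right\rceil$ and let $n_1<n_2<\cdots<n_s$ be the ascending arrangement of all distinct elements of $$\left\{\left\lceil\left(\frac{2\varepsilon^2}{\ln\frac{1}{1-\varepsilon}}\right)^{1-\frac{i}{\tau}}\frac{\ln\frac{1}{\zeta\delta}}{2\varepsilon^2}\right\rceil : i=0,1,\ldots,\tau\right\}.$$ Let $p\in(0,1)$ and let $X_1,X_2,\ldots$ be i.i.d. Bernoulli random variables with $\Pr\{X_i=1\}=1-\Pr\{X_i=0\}=p$. Define $K_\ell=\sum_{i=1}^{n_\ell}X_i$ and $\widehat{p}_\ell=\frac{K_\ell}{n_\ell}$ for $\ell=1,\ldots,s$. Suppose sampling is continued until $S_{\mathrm B}(K_\ell,n_\ell,n_\ell,\widehat{p}_\ell-\varepsilon)\le\zeta\delta$ and $S_{\mathrm B}(0,K_\ell,n_\ell,\widehat{p}_\ell+\varepsilon)\le\zeta\delta$ for some $\ell\in\{1,\ldots,s\}$. Let $\widehat{p}=\frac{\sum_{i=1}^{\mathbf n}X_i}{\mathbf n}$, where $\mathbf n$ is the sample size when the sampling is terminated. Then $\Pr\{|\widehat{p}-p|<\varepsilon\}\ge 1-\delta$ for every $p\in(0,1)$, provided that $0<\zeta\le\frac{1}{2(\tau+1)}$.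
   Context: For integers $0\le k\le l\le n$ and real $p$, $S_{\mathrm B}(k,l,n,p)=\sum_{i=k}^{l}\binom{n}{i}p^i(1-p)^{n-i}$ if $p\in(0,1)$, and $S_{\mathrm B}(k,l,n,p)=0$ if $p\notin(0,1)$. The sampling proceeds through stages $\ell=1,2,\ldots,s$, where at stage $\ell$ a total of $n_\ell$ samples has been observed; it terminates at the first stage $\ell$ at which the stopping condition holds, and then $\mathbf n=n_\ell$ and $\widehat{p}=\widehat{p}_\ell$. *)

theory Defs
  imports "HOL-Probability.Probability"
begin

definition S_B :: "nat \<Rightarrow> nat \<Rightarrow> nat \<Rightarrow> real \<Rightarrow> real" where
  "S_B k l n p =
     (if p \<in> {0<..<1} then \<Sum>i=k..l. real (n choose i) * p ^ i * (1 - p) ^ (n - i) else 0)"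

text \<open>
  For \<open>0 < \<epsilon> < 1/2\<close> and \<open>\<rho> > 0\<close> the ceiling below is positive, so \<open>nat\<close> does not truncate.
\<close>

definition max_index :: "real \<Rightarrow> real \<Rightarrow> nat" where
  "max_index \<epsilon> \<rho> = nat \<lceil>ln (1 / (2 * \<epsilon>\<^sup>2) * ln (1 / (1 - \<epsilon>))) / ln (1 + \<rho>)\<rceil>"

text \<open>
  The ceilings are positive as soon as additionally \<open>0 < \<zeta> * \<delta> < 1\<close>.
\<close>

definition sample_sizes :: "real \<Rightarrow> real \<Rightarrow> real \<Rightarrow> real \<Rightarrow> nat set" where
  "sample_sizes \<epsilon> \<delta> \<zeta> \<rho> =
     {nat \<lceil>(2 * \<epsilon>\<^sup>2 / ln (1 / (1 - \<epsilon>))) powr (1 - real i / real (max_index \<epsilon> \<rho>))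
            * (ln (1 / (\<zeta> * \<delta>)) / (2 * \<epsilon>\<^sup>2))\<rceil> | i. i \<in> {0..max_index \<epsilon> \<rho>}}"

definition success_count :: "(nat \<Rightarrow> 'a \<Rightarrow> nat) \<Rightarrow> nat \<Rightarrow> 'a \<Rightarrow> nat" where
  "success_count X m \<omega> = (\<Sum>i=1..m. X i \<omega>)"

definition sample_mean :: "(nat \<Rightarrow> 'a \<Rightarrow> nat) \<Rightarrow> nat \<Rightarrow> 'a \<Rightarrow> real" where
  "sample_mean X m \<omega> = real (success_count X m \<omega>) / real m"

text \<open>
  The sample sizes are given by a function \<open>n\<close> used at the arguments \<open>1, \<dots>, s\<close>.
\<close>

definition stop_condition ::
    "real \<Rightarrow> real \<Rightarrow> real \<Rightarrow> (nat \<Rightarrow> nat) \<Rightarrow> (nat \<Rightarrow> 'a \<Rightarrow> nat) \<Rightarrow> nat \<Rightarrow> 'a \<Rightarrow> bool" where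
  "stop_condition \<epsilon> \<delta> \<zeta> n X l \<omega> \<longleftrightarrow>
     S_B (success_count X (n l) \<omega>) (n l) (n l) (sample_mean X (n l) \<omega> - \<epsilon>) \<le> \<zeta> * \<delta> \<and>
     S_B 0 (success_count X (n l) \<omega>) (n l) (sample_mean X (n l) \<omega> + \<epsilon>) \<le> \<zeta> * \<delta>"

definition terminates ::
    "real \<Rightarrow> real \<Rightarrow> real \<Rightarrow> (nat \<Rightarrow> nat) \<Rightarrow> nat \<Rightarrow> (nat \<Rightarrow> 'a \<Rightarrow> nat) \<Rightarrow> 'a \<Rightarrow> bool" where
  "terminates \<epsilon> \<delta> \<zeta> n s X \<omega> \<longleftrightarrow> (\<exists>l\<in>{1..s}. stop_condition \<epsilon> \<delta> \<zeta> n X l \<omega>)"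

text \<open>
  The final sample size and the final estimate are meaningful only on outcomes for which
  the sampling terminates; elsewhere \<open>LEAST\<close> is unspecified.
\<close>

definition final_sample_size ::
    "real \<Rightarrow> real \<Rightarrow> real \<Rightarrow> (nat \<Rightarrow> nat) \<Rightarrow> nat \<Rightarrow> (nat \<Rightarrow> 'a \<Rightarrow> nat) \<Rightarrow> 'a \<Rightarrow> nat" where
  "final_sample_size \<epsilon> \<delta> \<zeta> n s X \<omega> =
     n (LEAST l. l \<in> {1..s} \<and> stop_condition \<epsilon> \<delta> \<zeta> n X l \<omega>)"

definition final_estimate ::
    "real \<Rightarrow> real \<Rightarrow> real \<Rightarrow> (nat \<Rightarrow> nat) \<Rightarrow> nat \<Rightarrow> (nat \<Rightarrow> 'a \<Rightarrow> nat) \<Rightarrow> 'a \<Rightarrow> real" where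
  "final_estimate \<epsilon> \<delta> \<zeta> n s X \<omega> = sample_mean X (final_sample_size \<epsilon> \<delta> \<zeta> n s X \<omega>) \<omega>"

end

theory Submission
  imports Defs
begin

text \<open>
  The largest sample size is at least \<open>ln (1 / (\<zeta> * \<delta>)) / (2 * \<epsilon>\<^sup>2)\<close>, so by Hoeffding's inequality
  the stopping condition holds there for every outcome and the sampling always terminates.
  If it stops at stage \<open>l\<close> with an estimate below \<open>p\<close> by at least \<open>\<epsilon>\<close>, then, since binomial lower
  tails decrease in the success probability, the binomial distribution function with the true
  parameter \<open>p\<close> takes a value at most \<open>\<zeta> * \<delta>\<close> at the observed success count; as for any
  distribution function, this has probability at most \<open>\<zeta> * \<delta>\<close>. The case of an estimate above \<open>p\<close>
  is symmetric, and a union bound over two sides and at most \<open>\<tau> + 1\<close> stages gives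
  \<open>2 * (\<tau> + 1) * \<zeta> * \<delta> \<le> \<delta>\<close>.
\<close>

section \<open>Binomial probabilities as functions of the success probability\<close>

text \<open>Condition on one of the trials. The form for arbitrary sets serves the induction below;
  singletons give the recursion for point masses.\<close>

lemma binomial_pmf_prob_Suc:
  assumes "p \<in> {0..1}"
  shows "measure_pmf.prob (binomial_pmf (Suc n) p) A =
    p * measure_pmf.prob (binomial_pmf n p) (Suc -` A) + (1 - p) * measure_pmf.prob (binomial_pmf n p) A"
proof -
  have "binomial_pmf (Suc n) p =
      bernoulli_pmf p \<bind> (\<lambda>b. map_pmf (if b then Suc else id) (binomial_pmf n p))"
    using assms by (auto simp: binomial_pmf_Suc map_pmf_def intro!: bind_pmf_cong)
  then have "emeasure (binomial_pmf (Suc n) p) A =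
      ennreal p * emeasure (binomial_pmf n p) (Suc -` A) + ennreal (1 - p) * emeasure (binomial_pmf n p) A"
    using assms by (simp add: mult.commute)
  also have "\<dots> = ennreal (p * measure_pmf.prob (binomial_pmf n p) (Suc -` A)
      + (1 - p) * measure_pmf.prob (binomial_pmf n p) A)"
    using assms by (simp add: measure_pmf.emeasure_eq_measure ennreal_mult ennreal_plus)
  finally show ?thesis
    using assms by (simp add: measure_pmf.emeasure_eq_measure del: ennreal_plus)
qed

lemma binomial_pmf_prob_antimono:
  fixes A :: "nat set"
  assumes "0 \<le> p" "p \<le> q" "q \<le> 1" and "\<And>x y. x \<le> y \<Longrightarrow> y \<in> A \<Longrightarrow> x \<in> A"
  shows "measure_pmf.prob (binomial_pmf n q) A \<le> measure_pmf.prob (binomial_pmf n p) A"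
  using assms(4)
proof (induction n arbitrary: A)
  case 0
  then show ?case using assms by (simp add: binomial_pmf_0)
next
  case (Suc n)
  let ?P = "\<lambda>p A. measure_pmf.prob (binomial_pmf n p) A"
  have sub: "Suc -` A \<subseteq> A"
    using Suc.prems by (metis le_SucI order_refl subsetI vimage_eq)
  have down: "\<And>x y. x \<le> y \<Longrightarrow> y \<in> Suc -` A \<Longrightarrow> x \<in> Suc -` A"
    using Suc.prems by (metis Suc_le_mono vimage_eq)
  have "q * ?P q (Suc -` A) + (1 - q) * ?P q A \<le> q * ?P p (Suc -` A) + (1 - q) * ?P p A"
    using Suc.IH[OF Suc.prems] Suc.IH[OF down] assms by (intro add_mono mult_left_mono) auto
  also have "\<dots> = ?P p A - q * (?P p A - ?P p (Suc -` A))"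
    by (simp add: algebra_simps)
  also have "\<dots> \<le> ?P p A - p * (?P p A - ?P p (Suc -` A))"
    using assms measure_pmf.finite_measure_mono[OF sub, of "binomial_pmf n p"]
    by (intro diff_left_mono mult_right_mono) auto
  also have "\<dots> = p * ?P p (Suc -` A) + (1 - p) * ?P p A"
    by (simp add: algebra_simps)
  finally show ?case
    using assms by (simp add: binomial_pmf_prob_Suc)
qed

section \<open>Monotonicity of the tails given by \<open>S_B\<close>\<close>

lemma S_B_lower:
  assumes "q \<in> {0<..<1}"
  shows "S_B 0 k n q = measure_pmf.prob (binomial_pmf n q) {..k}"
  using assms by (simp add: S_B_def measure_measure_pmf_finite atLeast0AtMost)

text \<open>The ray \<open>{k..}\<close> adds only points outside the support, and its complement
  \<open>{..<k}\<close> is closed downwards.\<close>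

lemma S_B_upper:
  assumes "q \<in> {0<..<1}"
  shows "S_B k n n q = measure_pmf.prob (binomial_pmf n q) {k..}"
proof -
  have "measure_pmf.prob (binomial_pmf n q) {k..} = measure_pmf.prob (binomial_pmf n q) {k..n}"
    using assms by (intro measure_pmf.finite_measure_eq_AE) (auto simp: AE_measure_pmf_iff)
  then show ?thesis
    using assms by (simp add: S_B_def measure_measure_pmf_finite)
qed

text \<open>The bound \<open>0 < p\<close> matters: at \<open>p \<le> 0\<close> the default value 0
  of \<open>S_B\<close> would break the inequality. For upper tails the same happens at
  \<open>q \<ge> 1\<close>.\<close>

lemma S_B_lower_antimono:
  assumes "0 < p" "p \<le> q" "q < 1"
  shows "S_B 0 k n q \<le> S_B 0 k n p"
  using assms by (auto simp: S_B_lower intro!: binomial_pmf_prob_antimono)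

lemma S_B_upper_mono:
  assumes "0 < p" "p \<le> q" "q < 1"
  shows "S_B k n n p \<le> S_B k n n q"
proof -
  have "measure_pmf.prob (binomial_pmf n q) {..<k} \<le> measure_pmf.prob (binomial_pmf n p) {..<k}"
    using assms by (intro binomial_pmf_prob_antimono) auto
  moreover have "{k..} = UNIV - {..<k}" by auto
  ultimately show ?thesis
    using assms measure_pmf.prob_compl[of "{..<k}" "binomial_pmf n p"]
      measure_pmf.prob_compl[of "{..<k}" "binomial_pmf n q"]
    by (simp add: S_B_upper)
qed

section \<open>Tail probabilities evaluated at the observation itself\<close>

text \<open>The set is an initial segment of the naturals. If finite and nonempty, it lies below its
  maximum, where the distribution function is at most \<alpha>. If infinite, the distribution
  function never exceeds \<alpha>, and its limit 1 forces \<open>1 \<le> \<alpha>\<close>.\<close>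

lemma pmf_prob_lower_tail_le:
  fixes P :: "nat pmf"
  assumes "0 \<le> \<alpha>"
  shows "measure_pmf.prob P {k. measure_pmf.prob P {..k} \<le> \<alpha>} \<le> \<alpha>"
proof (cases "finite {k. measure_pmf.prob P {..k} \<le> \<alpha>}")
  case True
  let ?A = "{k. measure_pmf.prob P {..k} \<le> \<alpha>}"
  show ?thesis
  proof (cases "?A = {}")
    case False
    then have "measure_pmf.prob P ?A \<le> measure_pmf.prob P {..Max ?A}"
      using True by (intro measure_pmf.finite_measure_mono) auto
    also have "\<dots> \<le> \<alpha>"
      using Max_in[OF True False] by simp
    finally show ?thesis .
  qed (use assms in \<open>simp only: measure_empty\<close>)
next
  case False
  have "measure_pmf.prob P {..k} \<le> \<alpha>" for k
  proof -
    obtain j where "k \<le> j" "measure_pmf.prob P {..j} \<le> \<alpha>"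
      using False by (metis (mono_tags, lifting) finite_nat_set_iff_bounded_le mem_Collect_eq nat_le_linear)
    moreover have "measure_pmf.prob P {..k} \<le> measure_pmf.prob P {..j}"
      using \<open>k \<le> j\<close> by (intro measure_pmf.finite_measure_mono) auto
    ultimately show ?thesis by simp
  qed
  moreover have "(\<lambda>k. measure_pmf.prob P {..k}) \<longlonglongrightarrow> measure_pmf.prob P (\<Union>k. {..k})"
    by (intro measure_pmf.finite_Lim_measure_incseq) (auto simp: incseq_def)
  ultimately have "1 \<le> \<alpha>"
    by (intro LIMSEQ_le_const2) (auto simp: UN_atMost_UNIV)
  then show ?thesis
    using measure_pmf.prob_le_1 order_trans by blast
qed

text \<open>No limit argument arises here: a nonempty set of naturals has a least element even when
  it is infinite.\<close>

lemma pmf_prob_upper_tail_le: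
  fixes P :: "nat pmf"
  assumes "0 \<le> \<alpha>"
  shows "measure_pmf.prob P {k. measure_pmf.prob P {k..} \<le> \<alpha>} \<le> \<alpha>"
proof (cases "{k. measure_pmf.prob P {k..} \<le> \<alpha>} = {}")
  case False
  let ?A = "{k. measure_pmf.prob P {k..} \<le> \<alpha>}"
  let ?m = "LEAST k. k \<in> ?A"
  have "measure_pmf.prob P ?A \<le> measure_pmf.prob P {?m..}"
    by (intro measure_pmf.finite_measure_mono) (auto intro: Least_le)
  also have "\<dots> \<le> \<alpha>"
    using LeastI_ex[of "\<lambda>k. k \<in> ?A"] False by blast
  finally show ?thesis .
qed (use assms in \<open>simp only: measure_empty\<close>)

lemma binomial_prob_underestimate:
  assumes "0 < p" "p < 1" "0 < \<epsilon>" "0 \<le> \<alpha>"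
  shows "measure_pmf.prob (binomial_pmf n p)
    {k. S_B 0 k n (real k / real n + \<epsilon>) \<le> \<alpha> \<and> real k / real n + \<epsilon> \<le> p} \<le> \<alpha>"
proof -
  \<comment> \<open>The random argument of \<open>S_B\<close> is moved up to the fixed
    \<open>p\<close>; it is positive since \<open>0 < \<epsilon>\<close>.\<close>
  have "S_B 0 k n p \<le> \<alpha>" if "S_B 0 k n (real k / real n + \<epsilon>) \<le> \<alpha>" "real k / real n + \<epsilon> \<le> p" for k
    using S_B_lower_antimono[of "real k / real n + \<epsilon>" p k n] that assms
    by (smt (verit) divide_nonneg_nonneg of_nat_0_le_iff)
  then have "measure_pmf.prob (binomial_pmf n p)
      {k. S_B 0 k n (real k / real n + \<epsilon>) \<le> \<alpha> \<and> real k / real n + \<epsilon> \<le> p}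
    \<le> measure_pmf.prob (binomial_pmf n p) {k. measure_pmf.prob (binomial_pmf n p) {..k} \<le> \<alpha>}"
    using assms by (intro measure_pmf.finite_measure_mono) (auto simp: S_B_lower)
  also have "\<dots> \<le> \<alpha>"
    using assms by (intro pmf_prob_lower_tail_le)
  finally show ?thesis .
qed

lemma binomial_prob_overestimate:
  assumes "0 < p" "p < 1" "0 < \<epsilon>" "0 \<le> \<alpha>"
  shows "measure_pmf.prob (binomial_pmf n p)
    {k. S_B k n n (real k / real n - \<epsilon>) \<le> \<alpha> \<and> p \<le> real k / real n - \<epsilon>} \<le> \<alpha>"
proof -
  \<comment> \<open>The restriction \<open>k \<le> n\<close> keeps the argument of
    \<open>S_B\<close> below 1, away from the default value. It holds almost surely, so the
    comparison of events below is an almost sure one.\<close>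
  have "S_B k n n p \<le> \<alpha>"
    if "k \<le> n" "S_B k n n (real k / real n - \<epsilon>) \<le> \<alpha>" "p \<le> real k / real n - \<epsilon>" for k
  proof -
    have "real k / real n \<le> 1"
      using that(1) by (auto simp: divide_le_eq_1)
    then show ?thesis
      using S_B_upper_mono[of p "real k / real n - \<epsilon>" k n] that assms by simp
  qed
  then have "measure_pmf.prob (binomial_pmf n p)
      {k. S_B k n n (real k / real n - \<epsilon>) \<le> \<alpha> \<and> p \<le> real k / real n - \<epsilon>}
    \<le> measure_pmf.prob (binomial_pmf n p) {k. measure_pmf.prob (binomial_pmf n p) {k..} \<le> \<alpha>}"
    using assms by (intro measure_pmf.finite_measure_mono_AE) (auto simp: S_B_upper AE_measure_pmf_iff)
  also have "\<dots> \<le> \<alpha>"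
    using assms by (intro pmf_prob_upper_tail_le)
  finally show ?thesis .
qed

section \<open>Hoeffding bounds for both tails\<close>

text \<open>With \<open>real k / real n + \<epsilon>\<close> as success probability, the tail
  \<open>{..k}\<close> says that the mean falls short of its expectation by at least \<epsilon>.
  Outside the open unit interval \<open>S_B\<close> is 0.\<close>

lemma S_B_lower_Hoeffding:
  assumes "0 < n" "0 \<le> \<epsilon>"
  shows "S_B 0 k n (real k / real n + \<epsilon>) \<le> exp (- 2 * real n * \<epsilon>\<^sup>2)"
proof (cases "real k / real n + \<epsilon> \<in> {0<..<1}")
  case True
  then have "binomial_distribution (real k / real n + \<epsilon>)"
    by unfold_locales auto
  from binomial_distribution.prob_le'[OF this assms]
  have "measure_pmf.prob (binomial_pmf n (real k / real n + \<epsilon>)) {x. real x / real n \<le> real k / real n}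
    \<le> exp (- 2 * real n * \<epsilon>\<^sup>2)" by simp
  moreover have "{x. real x / real n \<le> real k / real n} = {..k}"
    using assms by (auto simp: divide_le_cancel)
  ultimately show ?thesis
    using True by (simp add: S_B_lower)
qed (simp only: S_B_def if_False exp_ge_zero)

lemma S_B_upper_Hoeffding:
  assumes "0 < n" "0 \<le> \<epsilon>"
  shows "S_B k n n (real k / real n - \<epsilon>) \<le> exp (- 2 * real n * \<epsilon>\<^sup>2)"
proof (cases "real k / real n - \<epsilon> \<in> {0<..<1}")
  case True
  then have "binomial_distribution (real k / real n - \<epsilon>)"
    by unfold_locales auto
  from binomial_distribution.prob_ge'[OF this assms]
  have "measure_pmf.prob (binomial_pmf n (real k / real n - \<epsilon>)) {x. real k / real n \<le> real x / real n}
    \<le> exp (- 2 * real n * \<epsilon>\<^sup>2)" by simp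
  moreover have "{x. real k / real n \<le> real x / real n} = {k..}"
    using assms by (auto simp: divide_le_cancel)
  ultimately show ?thesis
    using True by (simp add: S_B_upper)
qed (simp only: S_B_def if_False exp_ge_zero)

section \<open>The set of sample sizes\<close>

text \<open>The argument of the outer logarithm exceeds 1, by \<open>2 * \<epsilon>\<^sup>2 <
  \<epsilon> \<le> ln (1 / (1 - \<epsilon>))\<close>. Positivity makes the division by
  \<open>max_index\<close> in the exponents meaningful.\<close>

lemma max_index_pos:
  assumes "0 < \<epsilon>" "\<epsilon> < 1 / 2" "0 < \<rho>"
  shows "0 < max_index \<epsilon> \<rho>"
proof -
  have "2 * \<epsilon>\<^sup>2 < \<epsilon>"
    using assms by (simp add: power2_eq_square)
  also have "\<epsilon> \<le> ln (1 / (1 - \<epsilon>))"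
    using ln_le_minus_one[of "1 - \<epsilon>"] assms by (simp add: ln_div)
  finally have "1 < 1 / (2 * \<epsilon>\<^sup>2) * ln (1 / (1 - \<epsilon>))"
    using assms by (simp add: field_simps)
  then have "0 < ln (1 / (2 * \<epsilon>\<^sup>2) * ln (1 / (1 - \<epsilon>)))"
    by (rule ln_gt_zero)
  then show ?thesis
    using assms unfolding max_index_def by simp
qed

lemma card_sample_sizes_le: "card (sample_sizes \<epsilon> \<delta> \<zeta> \<rho>) \<le> max_index \<epsilon> \<rho> + 1"
proof -
  have "sample_sizes \<epsilon> \<delta> \<zeta> \<rho> = (\<lambda>i. nat \<lceil>(2 * \<epsilon>\<^sup>2 / ln (1 / (1 - \<epsilon>))) powr (1 - real i / real (max_index \<epsilon> \<rho>))
            * (ln (1 / (\<zeta> * \<delta>)) / (2 * \<epsilon>\<^sup>2))\<rceil>) ` {0..max_index \<epsilon> \<rho>}"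
    by (auto simp: sample_sizes_def)
  then show ?thesis
    using card_image_le[of "{0..max_index \<epsilon> \<rho>}"] by simp
qed

text \<open>This is the element for \<open>i = max_index \<epsilon> \<rho>\<close>, where the
  exponent vanishes.\<close>

lemma Hoeffding_sample_size:
  assumes "0 < \<epsilon>" "\<epsilon> < 1 / 2" "0 < \<rho>"
  shows "nat \<lceil>ln (1 / (\<zeta> * \<delta>)) / (2 * \<epsilon>\<^sup>2)\<rceil> \<in> sample_sizes \<epsilon> \<delta> \<zeta> \<rho>"
proof -
  have "1 < 1 / (1 - \<epsilon>)"
    using assms by (simp add: field_simps)
  \<comment> \<open>Needed because \<open>0 powr 0\<close> is 0; only a nonzero base gives the
    factor 1.\<close>
  then have "2 * \<epsilon>\<^sup>2 / ln (1 / (1 - \<epsilon>)) \<noteq> 0"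
    using assms ln_gt_zero[of "1 / (1 - \<epsilon>)"] by simp
  then show ?thesis
    using max_index_pos[OF assms] unfolding sample_sizes_def
    by (intro CollectI exI[of _ "max_index \<epsilon> \<rho>"]) simp
qed

section \<open>Law of the success count\<close>

lemma (in prob_space) success_count_measurable:
  assumes "indep_vars (\<lambda>_. count_space UNIV) X {1..}"
  shows "success_count X m \<in> measurable M (count_space UNIV)"
proof -
  have "X i \<in> measurable M (count_space UNIV)" if "i \<in> {1..m}" for i
    using assms that by (auto simp: indep_vars_def)
  then show ?thesis
    unfolding success_count_def[abs_def] by measurable
qed

text \<open>Induction on the number of trials: the last one is independent of the sum of the others,
  which yields the binomial recursion.\<close>

lemma (in prob_space) prob_success_count_eq:
  fixes X :: "nat \<Rightarrow> 'a \<Rightarrow> nat"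
  assumes p: "0 \<le> p" "p \<le> 1"
    and ind: "indep_vars (\<lambda>_. count_space UNIV) X {1..}"
    and X1: "\<And>i. i \<ge> 1 \<Longrightarrow> \<P>(\<omega> in M. X i \<omega> = 1) = p"
    and X0: "\<And>i. i \<ge> 1 \<Longrightarrow> \<P>(\<omega> in M. X i \<omega> = 0) = 1 - p"
  shows "\<P>(\<omega> in M. success_count X m \<omega> = k) = pmf (binomial_pmf m p) k"
proof (induction m arbitrary: k)
  case 0
  then show ?case
    using p by (cases k) (simp_all add: success_count_def binomial_pmf_0 prob_space del: pmf_binomial)
next
  case (Suc m)
  let ?N = "count_space (UNIV :: nat set)"
  note [measurable] = success_count_measurable[OF ind]
  have [measurable]: "X (Suc m) \<in> measurable M ?N"
    using ind by (auto simp: indep_vars_def)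
  \<comment> \<open>Independence passes to functions of the disjoint index blocks
    \<open>{Suc m}\<close> and \<open>{1..m}\<close>.\<close>
  have "indep_var ?N ((\<lambda>f. f (Suc m)) \<circ> (\<lambda>\<omega>. restrict (\<lambda>i. X i \<omega>) {Suc m}))
      ?N ((\<lambda>f. \<Sum>i=1..m. f i) \<circ> (\<lambda>\<omega>. restrict (\<lambda>i. X i \<omega>) {1..m}))"
    by (intro indep_var_compose[OF indep_var_restrict[OF ind]]) auto
  moreover have "(\<lambda>f. \<Sum>i=1..m. f i) \<circ> (\<lambda>\<omega>. restrict (\<lambda>i. X i \<omega>) {1..m}) = success_count X m"
    by (auto simp: fun_eq_iff success_count_def intro!: sum.cong)
  ultimately have iv: "indep_var ?N (X (Suc m)) ?N (success_count X m)"
    by (simp add: comp_def)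
  have split: "\<P>(\<omega> in M. X (Suc m) \<omega> = a \<and> success_count X m \<omega> = b) =
      \<P>(\<omega> in M. X (Suc m) \<omega> = a) * pmf (binomial_pmf m p) b" for a b
    using indep_varD[OF iv, of "{a}" "{b}"] Suc.IH[of b]
    by (simp add: vimage_def Int_def conj_commute)
  \<comment> \<open>The variables may take any natural value; that they are 0 or 1 almost surely
    follows from \<open>(1 - p) + p = 1\<close>.\<close>
  have "\<P>(\<omega> in M. X (Suc m) \<omega> = 0 \<or> X (Suc m) \<omega> = 1) =
     \<P>(\<omega> in M. X (Suc m) \<omega> = 0) + \<P>(\<omega> in M. X (Suc m) \<omega> = 1)"
    by (subst finite_measure_Union[symmetric]) (auto intro!: arg_cong[where f = prob])
  then have "\<P>(\<omega> in M. X (Suc m) \<omega> = 0 \<or> X (Suc m) \<omega> = 1) = 1"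
    using X0[of "Suc m"] X1[of "Suc m"] by simp
  then have ae: "AE \<omega> in M. X (Suc m) \<omega> = 0 \<or> X (Suc m) \<omega> = 1"
    by (subst (asm) prob_Collect_eq_1) auto
  have succ: "success_count X (Suc m) \<omega> = success_count X m \<omega> + X (Suc m) \<omega>" for \<omega>
    by (simp add: success_count_def)
  show ?case
  proof (cases k)
    case 0
    \<comment> \<open>Here the events coincide exactly: a sum of naturals is 0 only if both terms
      are. For positive \<open>k\<close> they agree only almost surely.\<close>
    have "\<P>(\<omega> in M. success_count X (Suc m) \<omega> = k) =
        \<P>(\<omega> in M. X (Suc m) \<omega> = 0 \<and> success_count X m \<omega> = 0)"
      by (intro arg_cong[where f = prob]) (auto simp: 0 succ)
    then show ?thesis
      using split[of 0 0] X0[of "Suc m"] p by (simp add: 0)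
  next
    case (Suc j)
    have "\<P>(\<omega> in M. success_count X (Suc m) \<omega> = k) =
        prob ({\<omega>\<in>space M. X (Suc m) \<omega> = 0 \<and> success_count X m \<omega> = Suc j} \<union>
          {\<omega>\<in>space M. X (Suc m) \<omega> = 1 \<and> success_count X m \<omega> = j})"
      using ae by (intro finite_measure_eq_AE) (auto simp: Suc succ)
    also have "\<dots> = (1 - p) * pmf (binomial_pmf m p) (Suc j) + p * pmf (binomial_pmf m p) j"
      using X0[of "Suc m"] X1[of "Suc m"]
      by (subst finite_measure_Union) (auto simp: split)
    also have "\<dots> = pmf (binomial_pmf (Suc m) p) (Suc j)"
      using p binomial_pmf_prob_Suc[of p m "{Suc j}"]
      by (simp add: measure_pmf_single vimage_def del: pmf_binomial)
    finally show ?thesis by (simp only: Suc)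
  qed
qed

text \<open>Measures on a countable type are compared on singletons. An arbitrary \<open>Q\<close>
  admits the events that combine a stopping inequality with a wrong estimate.\<close>

lemma (in prob_space) prob_success_count:
  fixes X :: "nat \<Rightarrow> 'a \<Rightarrow> nat"
  assumes p: "0 \<le> p" "p \<le> 1"
    and ind: "indep_vars (\<lambda>_. count_space UNIV) X {1..}"
    and X1: "\<And>i. i \<ge> 1 \<Longrightarrow> \<P>(\<omega> in M. X i \<omega> = 1) = p"
    and X0: "\<And>i. i \<ge> 1 \<Longrightarrow> \<P>(\<omega> in M. X i \<omega> = 0) = 1 - p"
  shows "\<P>(\<omega> in M. Q (success_count X m \<omega>)) = measure_pmf.prob (binomial_pmf m p) {k. Q k}"
proof -
  note [measurable] = success_count_measurable[OF ind]
  have "distr M (count_space UNIV) (success_count X m) = measure_pmf (binomial_pmf m p)"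
  proof (rule measure_eqI_countable)
    fix k :: nat
    have "emeasure (distr M (count_space UNIV) (success_count X m)) {k} =
        \<P>(\<omega> in M. success_count X m \<omega> = k)"
      by (simp add: emeasure_distr emeasure_eq_measure vimage_def Int_def conj_commute)
    then show "emeasure (distr M (count_space UNIV) (success_count X m)) {k} =
        emeasure (measure_pmf (binomial_pmf m p)) {k}"
      using prob_success_count_eq[OF assms] by (simp add: emeasure_pmf_single)
  qed auto
  then have "measure_pmf.prob (binomial_pmf m p) {k. Q k} =
      measure (distr M (count_space UNIV) (success_count X m)) {k. Q k}"
    by simp
  also have "\<dots> = \<P>(\<omega> in M. Q (success_count X m \<omega>))"
    by (simp add: measure_distr vimage_def Int_def conj_commute)
  finally show ?thesis ..
qed


section \<open>Termination and coverage probability\<close>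

text \<open>The size condition amounts to \<open>exp (- 2 * real (n l) * \<epsilon>\<^sup>2) \<le>
  \<zeta> * \<delta>\<close>. Hoeffding is applied to the binomial tails in \<open>S_B\<close>, not
  to \<open>X\<close>, so the conclusion holds for every outcome.\<close>

lemma stop_condition_Hoeffding:
  assumes "0 < \<epsilon>" "0 < \<zeta> * \<delta>" "0 < n l" "ln (1 / (\<zeta> * \<delta>)) / (2 * \<epsilon>\<^sup>2) \<le> real (n l)"
  shows "stop_condition \<epsilon> \<delta> \<zeta> n X l \<omega>"
proof -
  have "- 2 * real (n l) * \<epsilon>\<^sup>2 \<le> ln (\<zeta> * \<delta>)"
    using assms ln_inverse[of "\<zeta> * \<delta>"] by (simp add: inverse_eq_divide field_simps del: ln_mult)
  then have "exp (- 2 * real (n l) * \<epsilon>\<^sup>2) \<le> \<zeta> * \<delta>"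
    using assms by (metis exp_le_cancel_iff exp_ln)
  then show ?thesis
    using S_B_lower_Hoeffding[OF \<open>0 < n l\<close>, of \<epsilon>] S_B_upper_Hoeffding[OF \<open>0 < n l\<close>, of \<epsilon>] assms(1)
    unfolding stop_condition_def sample_mean_def by (meson less_imp_le order_trans)
qed

text \<open>Replacing \<open>LEAST\<close> by bounded quantifiers over stages makes the
  measurability of the event evident.\<close>

lemma terminates_accurate_iff:
  "terminates \<epsilon> \<delta> \<zeta> n s X \<omega> \<and> \<bar>final_estimate \<epsilon> \<delta> \<zeta> n s X \<omega> - p\<bar> < \<epsilon> \<longleftrightarrow>
    (\<exists>l\<in>{1..s}. stop_condition \<epsilon> \<delta> \<zeta> n X l \<omega> \<and> (\<forall>j\<in>{1..<l}. \<not> stop_condition \<epsilon> \<delta> \<zeta> n X j \<omega>) \<and>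
      \<bar>sample_mean X (n l) \<omega> - p\<bar> < \<epsilon>)" (is "?L \<longleftrightarrow> ?R")
proof
  let ?Q = "\<lambda>l. l \<in> {1..s} \<and> stop_condition \<epsilon> \<delta> \<zeta> n X l \<omega>"
  assume L: ?L
  then have "\<exists>l. ?Q l"
    by (auto simp: terminates_def)
  then have "?Q (LEAST l. ?Q l)"
    by (rule LeastI_ex)
  moreover from this have "\<not> stop_condition \<epsilon> \<delta> \<zeta> n X j \<omega>" if "j \<in> {1..<LEAST l. ?Q l}" for j
    using not_less_Least[of j ?Q] that by auto
  ultimately show ?R
    using L unfolding final_estimate_def final_sample_size_def by blast
next
  assume ?R
  then obtain l where l: "l \<in> {1..s}" "stop_condition \<epsilon> \<delta> \<zeta> n X l \<omega>"
    "\<forall>j\<in>{1..<l}. \<not> stop_condition \<epsilon> \<delta> \<zeta> n X j \<omega>" "\<bar>sample_mean X (n l) \<omega> - p\<bar> < \<epsilon>"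
    by blast
  then have "(LEAST l. l \<in> {1..s} \<and> stop_condition \<epsilon> \<delta> \<zeta> n X l \<omega>) = l"
    by (intro Least_equality) (auto simp: not_less[symmetric])
  then have "final_estimate \<epsilon> \<delta> \<zeta> n s X \<omega> = sample_mean X (n l) \<omega>"
    by (simp only: final_estimate_def final_sample_size_def)
  with l show ?L
    by (auto simp: terminates_def)
qed

theorem theorem1:
  fixes M :: "'a measure" and X :: "nat \<Rightarrow> 'a \<Rightarrow> nat"
    and \<epsilon> \<delta> \<zeta> \<rho> p :: real and n :: "nat \<Rightarrow> nat" and s :: nat
  assumes "0 < \<epsilon>" and "\<epsilon> < 1 / 2" and "0 < \<delta>" and "\<delta> < 1" and "0 < \<zeta>" and "0 < \<rho>"
    and "strict_mono_on {1..s} n"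
    and "n ` {1..s} = sample_sizes \<epsilon> \<delta> \<zeta> \<rho>"
    and "0 < p" and "p < 1"
    and "prob_space M"
    and "prob_space.indep_vars M (\<lambda>_. count_space UNIV) X {1..}"
    and "\<And>i. i \<ge> 1 \<Longrightarrow> \<P>(\<omega> in M. X i \<omega> = 1) = p"
    and "\<And>i. i \<ge> 1 \<Longrightarrow> \<P>(\<omega> in M. X i \<omega> = 0) = 1 - p"
    and "\<zeta> \<le> 1 / (2 * (real (max_index \<epsilon> \<rho>) + 1))"
  shows "\<P>(\<omega> in M. terminates \<epsilon> \<delta> \<zeta> n s X \<omega> \<and>
             \<bar>final_estimate \<epsilon> \<delta> \<zeta> n s X \<omega> - p\<bar> < \<epsilon>) \<ge> 1 - \<delta>"
proof -
  interpret prob_space M by fact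
  note [measurable] = success_count_measurable[OF assms(12)]
  let ?stop = "stop_condition \<epsilon> \<delta> \<zeta> n X"
  have stop_meas [measurable]: "Measurable.pred M (?stop l)" for l
    unfolding stop_condition_def sample_mean_def by measurable
  have mean_meas [measurable]: "sample_mean X m \<in> borel_measurable M" for m
    unfolding sample_mean_def[abs_def] by measurable
  define E where "E = {\<omega>\<in>space M. terminates \<epsilon> \<delta> \<zeta> n s X \<omega> \<and> \<bar>final_estimate \<epsilon> \<delta> \<zeta> n s X \<omega> - p\<bar> < \<epsilon>}"
  \<comment> \<open>\<open>Lo\<close> and \<open>Up\<close> drop the demand that \<open>l\<close> be
    the first stopping stage, so each depends on a single success count, whose law is
    binomial.\<close>
  define Lo where "Lo l = {\<omega>\<in>space M. S_B 0 (success_count X (n l) \<omega>) (n l)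
      (real (success_count X (n l) \<omega>) / real (n l) + \<epsilon>) \<le> \<zeta> * \<delta> \<and>
      real (success_count X (n l) \<omega>) / real (n l) + \<epsilon> \<le> p}" for l
  define Up where "Up l = {\<omega>\<in>space M. S_B (success_count X (n l) \<omega>) (n l) (n l)
      (real (success_count X (n l) \<omega>) / real (n l) - \<epsilon>) \<le> \<zeta> * \<delta> \<and>
      p \<le> real (success_count X (n l) \<omega>) / real (n l) - \<epsilon>}" for l
  have E_sets: "E \<in> sets M"
    unfolding E_def terminates_accurate_iff by measurable
  have Lo_sets: "Lo l \<in> sets M" and Up_sets: "Up l \<in> sets M" for l
    unfolding Lo_def Up_def by measurable

  \<comment> \<open>Aim: \<open>\<zeta> * \<delta> < 1\<close>, so that the logarithm is positive
    and the sample size at stage \<open>t\<close> is not 0.\<close>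
  have "1 / (2 * (real (max_index \<epsilon> \<rho>) + 1)) \<le> 1"
    by (simp add: field_simps)
  then have "\<zeta> * \<delta> < 1"
    using assms(3-5,15) by (smt (verit) mult_le_one mult_less_cancel_left2)
  moreover have zd: "0 < \<zeta> * \<delta>"
    using assms by simp
  ultimately have "0 < ln (1 / (\<zeta> * \<delta>)) / (2 * \<epsilon>\<^sup>2)"
    using assms(1) by (intro divide_pos_pos ln_gt_zero) (simp_all add: less_divide_eq)
  moreover obtain t where t: "t \<in> {1..s}" "n t = nat \<lceil>ln (1 / (\<zeta> * \<delta>)) / (2 * \<epsilon>\<^sup>2)\<rceil>"
    using Hoeffding_sample_size[OF assms(1,2,6), of \<zeta> \<delta>] assms(8) by (metis imageE)
  ultimately have "0 < n t" "ln (1 / (\<zeta> * \<delta>)) / (2 * \<epsilon>\<^sup>2) \<le> real (n t)"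
    by (auto simp: real_nat_ceiling_ge)
  then have stop: "?stop t \<omega>" for \<omega>
    using assms(1) zd by (intro stop_condition_Hoeffding)

  have cover: "space M - E \<subseteq> (\<Union>l\<in>{1..s}. Lo l \<union> Up l)"
  proof
    fix \<omega> assume \<omega>: "\<omega> \<in> space M - E"
    define l where "l = (LEAST l. l \<in> {1..s} \<and> ?stop l \<omega>)"
    \<comment> \<open>Stage \<open>t\<close> always stops, so this \<open>LEAST\<close> is a genuine
      first stopping stage.\<close>
    have l: "l \<in> {1..s}" "?stop l \<omega>"
      using LeastI[of "\<lambda>l. l \<in> {1..s} \<and> ?stop l \<omega>" t] t stop unfolding l_def by blast+
    have "terminates \<epsilon> \<delta> \<zeta> n s X \<omega>"
      using l by (auto simp: terminates_def)
    moreover have "final_estimate \<epsilon> \<delta> \<zeta> n s X \<omega> = sample_mean X (n l) \<omega>"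
      by (simp only: final_estimate_def final_sample_size_def l_def)
    ultimately have "\<bar>sample_mean X (n l) \<omega> - p\<bar> \<ge> \<epsilon>"
      using \<omega> by (auto simp: E_def)
    with l \<omega> have "\<omega> \<in> Lo l \<union> Up l"
      by (auto simp: Lo_def Up_def stop_condition_def sample_mean_def)
    with l show "\<omega> \<in> (\<Union>l\<in>{1..s}. Lo l \<union> Up l)" by blast
  qed

  note law = prob_success_count[OF less_imp_le[OF assms(9)] less_imp_le[OF assms(10)] assms(12-14)]
  have "prob (Lo l) = measure_pmf.prob (binomial_pmf (n l) p)
      {k. S_B 0 k (n l) (real k / real (n l) + \<epsilon>) \<le> \<zeta> * \<delta> \<and> real k / real (n l) + \<epsilon> \<le> p}" for l
    unfolding Lo_def
    by (rule law[of "\<lambda>k. S_B 0 k (n l) (real k / real (n l) + \<epsilon>) \<le> \<zeta> * \<delta> \<and> real k / real (n l) + \<epsilon> \<le> p"])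
  then have "prob (Lo l) \<le> \<zeta> * \<delta>" for l
    using binomial_prob_underestimate[of p \<epsilon> "\<zeta> * \<delta>" "n l"] assms(1,9,10) zd by simp
  moreover have "prob (Up l) = measure_pmf.prob (binomial_pmf (n l) p)
      {k. S_B k (n l) (n l) (real k / real (n l) - \<epsilon>) \<le> \<zeta> * \<delta> \<and> p \<le> real k / real (n l) - \<epsilon>}" for l
    unfolding Up_def
    by (rule law[of "\<lambda>k. S_B k (n l) (n l) (real k / real (n l) - \<epsilon>) \<le> \<zeta> * \<delta> \<and> p \<le> real k / real (n l) - \<epsilon>"])
  then have "prob (Up l) \<le> \<zeta> * \<delta>" for l
    using binomial_prob_overestimate[of p \<epsilon> "\<zeta> * \<delta>" "n l"] assms(1,9,10) zd by simp
  ultimately have stage: "prob (Lo l \<union> Up l) \<le> 2 * (\<zeta> * \<delta>)" for l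
    using measure_Un_le[OF Lo_sets[of l] Up_sets[of l]] by (smt (verit))

  \<comment> \<open>Strict monotonicity makes \<open>s\<close> the number of distinct sizes;
    different indices may give the same ceiling, hence only an inequality.\<close>
  have "s \<le> max_index \<epsilon> \<rho> + 1"
    using card_image[OF strict_mono_on_imp_inj_on[OF assms(7)]] card_sample_sizes_le[of \<epsilon> \<delta> \<zeta> \<rho>] assms(8)
    by simp
  have "prob (space M - E) \<le> prob (\<Union>l\<in>{1..s}. Lo l \<union> Up l)"
    using cover Lo_sets Up_sets by (intro finite_measure_mono) auto
  also have "\<dots> \<le> (\<Sum>l\<in>{1..s}. prob (Lo l \<union> Up l))"
    using Lo_sets Up_sets by (intro finite_measure_subadditive_finite) auto
  also have "\<dots> \<le> (\<Sum>l\<in>{1..s}. 2 * (\<zeta> * \<delta>))"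
    by (intro sum_mono stage)
  also have "\<dots> = real s * (2 * (\<zeta> * \<delta>))"
    by simp
  also have "\<dots> \<le> (real (max_index \<epsilon> \<rho>) + 1) * (2 * (\<zeta> * \<delta>))"
    using \<open>s \<le> max_index \<epsilon> \<rho> + 1\<close> zd by (intro mult_right_mono) auto
  also have "\<dots> = (\<zeta> * (2 * (real (max_index \<epsilon> \<rho>) + 1))) * \<delta>"
    by simp
  also have "\<dots> \<le> 1 * \<delta>"
    using assms(3,15) by (intro mult_right_mono) (simp_all add: le_divide_eq)
  finally have "1 - \<delta> \<le> prob E"
    using prob_compl[OF E_sets] by simp
  then show ?thesis
    unfolding E_def .
qed

end
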